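(* Let $d\in\mathbb{N}$ and let $b\in\mathbb{R}^d$ satisfy $b_1\ge b_2\ge\dots\ge b_d$. Let $S_i:=\sum_{j=1}^i b_j$ for $i=1,\dots,d$, and $b_0:=+\infty$, $S_0:=0$, $b_{d+1}:=-\infty$, $S_{d+1}:=S_d$. Let $k_0\in\{0,1,\dots,d\}$ be the (unique) index with $$b_{k_0}\ge\frac{S_{k_0}}{k_0+1}\quad\text{and}\quad b_{k_0+1}<\frac{S_{k_0+1}}{k_0+2}.$$ Then $(x^\ast,\lambda^\ast)\in\mathbb{R}^d\times\mathbb{R}^d$ defined by $$x_i^\ast:=\begin{cases}\frac12\left(\frac{S_{k_0}}{1+k_0}-b_i\right)&(i=1,\dots,k_0)\\0&(i=k_0+1,\dots,d),\end{cases}\qquad \lambda_i^\ast:=\begin{cases}0&(i=1,\dots,k_0)\\ \frac{S_{k_0}}{1+k_0}-b_i&(i=k_0+1,\dots,d)\end{cases}$$ is the KKT point of the problem $$\min_{x\in\mathbb{R}^d}\ \tfrac12x^\top Q_dx+b^\top x\quad\text{subject to }x\le\mathbf{0}_d .$$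
   Context: $Q_d:=2\mathrm{I}_d+2\mathrm{J}_d$, where $\mathrm{I}_d$ is the identity matrix and $\mathrm{J}_d$ is the $d\times d$ all-ones matrix. Vector inequalities are entrywise. A KKT point of the problem is a pair $(x^\ast,\lambda^\ast)\in\mathbb{R}^d\times\mathbb{R}^d$ satisfying $Q_dx^\ast+b+\lambda^\ast=\mathbf{0}$, $x^\ast\le\mathbf{0}$, $\lambda^\ast\ge\mathbf{0}$ and $x^{\ast\top}\lambda^\ast=0$. *)

theory Defs
  imports "Jordan_Normal_Form.Matrix" "HOL-Library.Extended_Real"
begin

text \<open>
  Vectors and matrices are those of \<^theory>\<open>Jordan_Normal_Form.Matrix\<close>, with
  entries numbered from 0: the mathematical entry b_i (1 \<le> i \<le> d) is \<^term>\<open>b $ (i - 1)\<close>.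
  The order on vectors is the entrywise one.
\<close>

definition all_ones_mat :: "nat \<Rightarrow> real mat" where
  "all_ones_mat d = mat d d (\<lambda>_. 1)"

definition Q_mat :: "nat \<Rightarrow> real mat" where
  "Q_mat d = 2 \<cdot>\<^sub>m 1\<^sub>m d + 2 \<cdot>\<^sub>m all_ones_mat d"

text \<open>KKT points of: minimise (1/2) x^T Q_d x + b^T x over x in R^d subject to x \<le> 0.\<close>

definition is_KKT_point :: "nat \<Rightarrow> real vec \<Rightarrow> real vec \<times> real vec \<Rightarrow> bool" where
  "is_KKT_point d b = (\<lambda>(x, l).
     x \<in> carrier_vec d \<and> l \<in> carrier_vec d \<and>
     Q_mat d *\<^sub>v x + b + l = 0\<^sub>v d \<and> x \<le> 0\<^sub>v d \<and> l \<ge> 0\<^sub>v d \<and> x \<bullet> l = 0)"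

text \<open>b_i for i = 0, ..., d+1, where b_0 = + \<infinity> and b_(d+1) = - \<infinity>.\<close>

definition b_ext :: "nat \<Rightarrow> real vec \<Rightarrow> nat \<Rightarrow> ereal" where
  "b_ext d b i = (if i = 0 then \<infinity> else if i \<le> d then ereal (b $ (i - 1)) else - \<infinity>)"

text \<open>S_i for i = 0, ..., d+1, where S_0 = 0 and S_(d+1) = S_d.\<close>

definition S_sum :: "nat \<Rightarrow> real vec \<Rightarrow> nat \<Rightarrow> real" where
  "S_sum d b i = (\<Sum>j = 1..min i d. b $ (j - 1))"

definition is_threshold_index :: "nat \<Rightarrow> real vec \<Rightarrow> nat \<Rightarrow> bool" where
  "is_threshold_index d b k \<longleftrightarrow> k \<in> {0..d} \<and>
     b_ext d b k \<ge> ereal (S_sum d b k / (real k + 1)) \<and>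
     b_ext d b (k + 1) < ereal (S_sum d b (k + 1) / (real k + 2))"

text \<open>Below, position i (counted from 0) holds the mathematical entry i + 1.\<close>

definition x_star :: "nat \<Rightarrow> real vec \<Rightarrow> nat \<Rightarrow> real vec" where
  "x_star d b k = vec d (\<lambda>i. if i + 1 \<le> k
     then 1 / 2 * (S_sum d b k / (1 + real k) - b $ i) else 0)"

definition lambda_star :: "nat \<Rightarrow> real vec \<Rightarrow> nat \<Rightarrow> real vec" where
  "lambda_star d b k = vec d (\<lambda>i. if i + 1 \<le> k
     then 0 else S_sum d b k / (1 + real k) - b $ i)"

end

theory Submission
  imports Defs
begin

text \<open>
  With b_0 and b_(d+1) infinite, the inequality b_i \<ge> S_i / (i + 1) holds at i = 0, fails at
  i = d + 1, and is inherited downwards because b is decreasing: for 1 \<le> i \<le> d it reads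
  i b_i \<ge> S_(i-1). So it changes truth value exactly once, which gives the threshold index, and
  the signs of x* and \<lambda>* follow from monotonicity of b. Uniqueness of the KKT point is strict
  convexity: for two KKT points, pairing the difference of the stationarity equations with x - y
  writes 0 as a sum of 2 |x - y|^2 and nonnegative terms.
\<close>

lemma S_sum_eq: "i \<le> d \<Longrightarrow> S_sum d b i = (\<Sum>j<i. b $ j)"
  unfolding S_sum_def
  by (simp add: min_def lessThan_atLeast0 sum.atLeast1_atMost_eq)

text \<open>S_i / (i + 1) is the mean of 0, b_1, ..., b_i. Both threshold conditions concern this
  one predicate, at k and at k + 1.\<close>

definition above_average :: "nat \<Rightarrow> real vec \<Rightarrow> nat \<Rightarrow> bool" where
  "above_average d b i \<longleftrightarrow> b_ext d b i \<ge> ereal (S_sum d b i / (real i + 1))"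

lemma above_average_0 [simp]: "above_average d b 0"
  by (simp add: above_average_def b_ext_def)

lemma above_average_beyond: "d < i \<Longrightarrow> \<not> above_average d b i"
  by (simp add: above_average_def b_ext_def)

text \<open>Multiply by i + 2 and cancel one copy of \<open>b $ i\<close>. The remaining quotient is
  the \<open>t\<close> of \<open>is_KKT_point_star\<close> for k = i, so failure at
  \<open>Suc k\<close> with k < d means \<open>b $ k < t\<close>.\<close>

lemma above_average_Suc:
  assumes "i < d"
  shows "above_average d b (Suc i) \<longleftrightarrow> (\<Sum>j<i. b $ j) / (1 + real i) \<le> b $ i"
  using assms
  by (simp add: above_average_def b_ext_def S_sum_eq divide_simps) (simp add: algebra_simps)

lemma is_threshold_index_iff:
  "is_threshold_index d b k \<longleftrightarrow> k \<le> d \<and> above_average d b k \<and> \<not> above_average d b (Suc k)"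
  by (auto simp: is_threshold_index_def above_average_def not_le add_ac)

lemma above_average_Suc_imp:
  assumes "\<And>i. i + 1 < d \<Longrightarrow> b $ i \<ge> b $ (i + 1)" and "above_average d b (Suc i)"
  shows "above_average d b i"
proof (cases i)
  case (Suc j)
  have "Suc j < d"
    using assms(2) Suc above_average_beyond[of d "Suc i" b] by force
  then have "(\<Sum>n<j. b $ n) + b $ j \<le> (2 + real j) * b $ Suc j"
    using assms(2) Suc by (simp add: above_average_Suc field_simps)
  \<comment> \<open>After this, one copy of \<open>b $ j\<close> cancels against the left
    side.\<close>
  also have "\<dots> \<le> (2 + real j) * b $ j"
    using assms(1)[of j] \<open>Suc j < d\<close> by (intro mult_left_mono) auto
  finally show ?thesis
    using Suc \<open>Suc j < d\<close> by (simp add: above_average_Suc field_simps)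
qed simp

lemma ex1_threshold_index:
  assumes "\<And>i. i + 1 < d \<Longrightarrow> b $ i \<ge> b $ (i + 1)"
  shows "\<exists>!k. is_threshold_index d b k"
proof -
  have mono: "above_average d b i" if "i \<le> j" "above_average d b j" for i j
    using that by (induction rule: inc_induct) (auto intro: above_average_Suc_imp[OF assms])
  have "\<exists>k\<le>d. above_average d b k \<and> \<not> above_average d b (Suc k)"
  proof (rule ccontr)
    assume no_drop: "\<not> ?thesis"
    \<comment> \<open>Without a drop, truth climbs from 0 up to d + 1, where b is minus
      infinity.\<close>
    have "i \<le> Suc d \<Longrightarrow> above_average d b i" for i
      using no_drop by (induction i) auto
    then show False
      using above_average_beyond[of d "Suc d" b] by simp
  qed
  \<comment> \<open>If k < k', truth at k' descends to \<open>Suc k\<close>, where k requires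
    failure.\<close>
  moreover have "k = k'" if "is_threshold_index d b k" "is_threshold_index d b k'" for k k'
    using that mono unfolding is_threshold_index_iff by (metis not_less_eq_eq nle_le)
  ultimately show ?thesis
    unfolding is_threshold_index_iff by blast
qed

lemma Q_mat_mult_vec_index:
  assumes "x \<in> carrier_vec d" "i < d"
  shows "(Q_mat d *\<^sub>v x) $ i = 2 * x $ i + 2 * (\<Sum>j<d. x $ j)"
proof -
  have "(Q_mat d *\<^sub>v x) $ i = (\<Sum>j<d. (if j = i then 2 * x $ j else 0) + 2 * x $ j)"
    using assms
    by (auto simp: Q_mat_def all_ones_mat_def scalar_prod_def lessThan_atLeast0 algebra_simps
        intro!: sum.cong)
  also have "\<dots> = 2 * x $ i + 2 * (\<Sum>j<d. x $ j)"
    using assms by (simp add: sum.distrib sum_distrib_left)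
  finally show ?thesis .
qed

lemma is_KKT_point_iff:
  assumes "b \<in> carrier_vec d"
  shows "is_KKT_point d b (x, l) \<longleftrightarrow>
    x \<in> carrier_vec d \<and> l \<in> carrier_vec d \<and>
    (\<forall>i<d. 2 * x $ i + 2 * (\<Sum>j<d. x $ j) + b $ i + l $ i = 0) \<and>
    (\<forall>i<d. x $ i \<le> 0) \<and> (\<forall>i<d. 0 \<le> l $ i) \<and> (\<Sum>i<d. x $ i * l $ i) = 0"
proof (cases "x \<in> carrier_vec d \<and> l \<in> carrier_vec d")
  case True
  have "Q_mat d *\<^sub>v x + b + l = 0\<^sub>v d \<longleftrightarrow>
      (\<forall>i<d. 2 * x $ i + 2 * (\<Sum>j<d. x $ j) + b $ i + l $ i = 0)"
    using True assms Q_mat_mult_vec_index[of x d]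
    by (auto simp: vec_eq_iff Q_mat_def all_ones_mat_def)
  moreover have "x \<le> 0\<^sub>v d \<longleftrightarrow> (\<forall>i<d. x $ i \<le> 0)"
    using True by (simp add: less_eq_vec_def carrier_vecD)
  moreover have "0\<^sub>v d \<le> l \<longleftrightarrow> (\<forall>i<d. 0 \<le> l $ i)"
    using True unfolding less_eq_vec_def by (metis carrier_vecD index_zero_vec)
  moreover have "x \<bullet> l = (\<Sum>i<d. x $ i * l $ i)"
    using True by (auto simp: scalar_prod_def lessThan_atLeast0)
  ultimately show ?thesis
    unfolding is_KKT_point_def prod.case by presburger
qed (auto simp: is_KKT_point_def)

lemma KKT_point_unique:
  assumes b: "b \<in> carrier_vec d"
    and xl: "is_KKT_point d b (x, l)" and ym: "is_KKT_point d b (y, m)"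
  shows "(x, l) = (y, m)"
proof -
  note X = xl[unfolded is_KKT_point_iff[OF b]] and Y = ym[unfolded is_KKT_point_iff[OF b]]
  \<comment> \<open>The all-ones part of \<open>Q_mat\<close> sees x - y only through this sum and
    adds 2 s^2 to the pairing.\<close>
  define s where "s = (\<Sum>j<d. x $ j - y $ j)"
  have diff: "2 * (x $ i - y $ i) + 2 * s + (l $ i - m $ i) = 0" if "i < d" for i
  proof -
    have "2 * x $ i + 2 * (\<Sum>j<d. x $ j) + b $ i + l $ i = 0"
      "2 * y $ i + 2 * (\<Sum>j<d. y $ j) + b $ i + m $ i = 0"
      using X Y that by blast+
    then show ?thesis
      unfolding s_def sum_subtractf by argo
  qed
  have "0 = (\<Sum>i<d. (x $ i - y $ i) * (2 * (x $ i - y $ i) + 2 * s + (l $ i - m $ i)))"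
    using diff by simp
  also have "\<dots> = (\<Sum>i<d. 2 * (x $ i - y $ i)\<^sup>2 + 2 * s * (x $ i - y $ i)
      + x $ i * l $ i + y $ i * m $ i - x $ i * m $ i - y $ i * l $ i)"
    by (intro sum.cong) (simp_all add: power2_eq_square algebra_simps)
  \<comment> \<open>Complementarity removes the products x l and y m. The cross products x m and y l
    survive, negated and hence nonnegative.\<close>
  also have "\<dots> = 2 * (\<Sum>i<d. (x $ i - y $ i)\<^sup>2) + 2 * s * s
      + (\<Sum>i<d. - (x $ i * m $ i)) + (\<Sum>i<d. - (y $ i * l $ i))"
    using X Y by (simp add: s_def sum.distrib sum_subtractf sum_negf flip: sum_distrib_left)
  finally have zero: "2 * (\<Sum>i<d. (x $ i - y $ i)\<^sup>2) + 2 * s * s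
      + (\<Sum>i<d. - (x $ i * m $ i)) + (\<Sum>i<d. - (y $ i * l $ i)) = 0" by simp
  have "0 \<le> (\<Sum>i<d. - (x $ i * m $ i))" "0 \<le> (\<Sum>i<d. - (y $ i * l $ i))"
    using X Y by (auto intro!: sum_nonneg simp: mult_nonpos_nonneg)
  moreover have "0 \<le> s * s" "0 \<le> (\<Sum>i<d. (x $ i - y $ i)\<^sup>2)"
    by (simp_all add: sum_nonneg)
  ultimately have "(\<Sum>i<d. (x $ i - y $ i)\<^sup>2) = 0" and "s * s = 0"
    using zero by linarith+
  then have xy: "x $ i = y $ i" if "i < d" for i
    using that by (simp add: sum_nonneg_eq_0_iff)
  \<comment> \<open>With x = y and s = 0, stationarity leaves only the difference of the
    multipliers.\<close>
  moreover have "l $ i = m $ i" if "i < d" for i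
    using diff[OF that] xy[OF that] \<open>s * s = 0\<close> by simp
  ultimately show ?thesis
    using X Y by auto
qed

text \<open>Once 2 times the sum of x is - t, stationarity reads 2 x_i + l_i = t - b_i. The sign of
  the right side, which changes at k, decides whether x_i or l_i carries it.\<close>

lemma is_KKT_point_star:
  assumes b: "b \<in> carrier_vec d"
    and decr: "\<And>i. i + 1 < d \<Longrightarrow> b $ i \<ge> b $ (i + 1)"
    and k: "is_threshold_index d b k"
  shows "is_KKT_point d b (x_star d b k, lambda_star d b k)"
proof -
  define t where "t = S_sum d b k / (1 + real k)"
  have "k \<le> d" and above: "above_average d b k" and below: "\<not> above_average d b (Suc k)"
    using k by (auto simp: is_threshold_index_iff)
  have anti: "b $ j \<le> b $ i" if "i \<le> j" "j < d" for i j
    using that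
  proof (induction rule: dec_induct)
    case (step n)
    then show ?case
      using decr[of n] by simp
  qed simp
  have high: "t \<le> b $ i" if "i < k" for i
  proof -
    \<comment> \<open>Position k - 1 holds b_k; since i < k, k is positive and b_k is
      finite.\<close>
    have "t \<le> b $ (k - 1)"
      using above that \<open>k \<le> d\<close> by (simp add: above_average_def b_ext_def t_def add_ac)
    also have "\<dots> \<le> b $ i"
      using that \<open>k \<le> d\<close> by (intro anti) auto
    finally show ?thesis .
  qed
  have low: "b $ i \<le> t" if "k \<le> i" "i < d" for i
  proof -
    have "b $ k < t"
      using below that \<open>k \<le> d\<close> by (simp add: above_average_Suc t_def S_sum_eq not_le)
    then show ?thesis
      using anti[of k i] that by simp
  qed
  have x: "x_star d b k $ i = (if i < k then (t - b $ i) / 2 else 0)"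
    and l: "lambda_star d b k $ i = (if i < k then 0 else t - b $ i)" if "i < d" for i
    using that by (auto simp: x_star_def lambda_star_def t_def)
  have "(\<Sum>i<d. x_star d b k $ i) = (\<Sum>i<k. (t - b $ i) / 2)"
    using \<open>k \<le> d\<close> by (intro sum.mono_neutral_cong_right) (auto simp: x)
  also have "\<dots> = (real k * t - S_sum d b k) / 2"
    using \<open>k \<le> d\<close> by (simp add: S_sum_eq sum_subtractf flip: sum_divide_distrib)
  \<comment> \<open>The definition of \<open>t\<close> gives S_k = (k + 1) t.\<close>
  also have "\<dots> = - t / 2"
    by (simp add: t_def field_simps)
  finally have "2 * (\<Sum>i<d. x_star d b k $ i) = - t"
    by simp
  then have "2 * x_star d b k $ i + 2 * (\<Sum>j<d. x_star d b k $ j) + b $ i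
      + lambda_star d b k $ i = 0"
    if "i < d" for i
    using that by (simp add: x l field_simps)
  moreover have "x_star d b k $ i \<le> 0" "0 \<le> lambda_star d b k $ i" if "i < d" for i
    using that high[of i] low[of i] by (auto simp: x l)
  moreover have "(\<Sum>i<d. x_star d b k $ i * lambda_star d b k $ i) = 0"
    by (intro sum.neutral) (auto simp: x l)
  moreover have "x_star d b k \<in> carrier_vec d" "lambda_star d b k \<in> carrier_vec d"
    by (simp_all add: x_star_def lambda_star_def)
  ultimately show ?thesis
    unfolding is_KKT_point_iff[OF b] by blast
qed

theorem theorem3p11:
  fixes d :: nat and b :: "real vec"
  assumes "b \<in> carrier_vec d"
    and "\<And>i. i + 1 < d \<Longrightarrow> b $ i \<ge> b $ (i + 1)"
  shows "(\<exists>!k0. is_threshold_index d b k0) \<and>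
    (\<forall>k0. is_threshold_index d b k0 \<longrightarrow>
       is_KKT_point d b (x_star d b k0, lambda_star d b k0) \<and>
       (\<forall>x l. is_KKT_point d b (x, l) \<longrightarrow>
          (x, l) = (x_star d b k0, lambda_star d b k0)))"
  using ex1_threshold_index[OF assms(2)] is_KKT_point_star[OF assms]
    KKT_point_unique[OF assms(1)]
  by blast

end
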